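(* Let $G=\mathrm{SO}(3,\mathbb{R})$ act on $X=\mathrm{SL}(3,\mathbb{R})$ by left multiplication, let $\Theta$ be the tetrahedron transformation on $X$ defined in the context, let $x_{eq}\in \mathrm{SL}(3,\mathbb{R})$ be a regular tetrahedron, and let $\mathcal{A}=Gx_{eq}=\{\rho x_{eq} : \rho\in \mathrm{SO}(3,\mathbb{R})\}$ be its orbit. Then $\mathcal{A}$ is a $3$-dimensional local attractor of $\Theta$. Moreover: (1) $\Theta(\mathcal{A})=\mathcal{A}$; (2) there exists an open neighborhood $U\subset \mathrm{SL}(3,\mathbb{R})$ of $\mathcal{A}$ such that for every $x\in U$ the limit $\lim_{n\to\infty}\Theta^n(x)=x^*$ exists and $x^*\in\mathcal{A}$.
   Context: Tetrahedra: a matrix $x=(x_1,x_2,x_3)\in \mathrm{GL}(3,\mathbb{R})$ with columns $x_1,x_2,x_3\in\mathbb{R}^3$ represents the non-degenerate tetrahedron with vertices $x_0=0,x_1,x_2,x_3$. The space of tetrahedra is $X=\mathrm{SL}(3,\mathbb{R})$. A tetrahedron is regular if all six edges have the same length. Face maps: put $\Delta_0=(x_0,x_1,x_3)$, $\Delta_1=(x_1,x_2,x_3)$, $\Delta_2=(x_2,x_0,x_3)$, $\Delta_3=(x_0,x_1,x_2)$. For $\Delta_i=(x_{i_0},x_{i_1},x_{i_2})$ let $c_i=\frac13(x_{i_0}+x_{i_1}+x_{i_2})$ and, for $j=0,1,2$ (index $j-1$ taken modulo $3$), $$\theta_{ij}(\Delta_i)=\frac{\|x_{i_{j-1}}-c_i\|}{\|x_{i_j}-c_i\|}\,(x_{i_j}-c_i)+c_i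 ,$$ where $\|\cdot\|$ is the Euclidean norm on $\mathbb{R}^3$. Tetrahedron transformation: let $s=\theta_{00}(\Delta_0)+\theta_{21}(\Delta_2)+\theta_{30}(\Delta_3)$ and let $\tilde\Theta(x)$ be the $3\times 3$ matrix whose columns are $\frac13\big(\theta_{01}(\Delta_0)+\theta_{10}(\Delta_1)+\theta_{31}(\Delta_3)-s\big)$, $\frac13\big(\theta_{11}(\Delta_1)+\theta_{20}(\Delta_2)+\theta_{32}(\Delta_3)-s\big)$, $\frac13\big(\theta_{02}(\Delta_0)+\theta_{12}(\Delta_1)+\theta_{22}(\Delta_2)-s\big)$. Whenever $\tilde\Theta(x)$ is invertible, put $\Theta(x)=\left(\frac{\det x}{\det\tilde\Theta(x)}\right)^{1/3}\tilde\Theta(x)$ (real cube root), so that $\det\Theta(x)=\det x$. $\Theta^n$ is the $n$-fold iterate; statements about $\Theta^n(x)$ include that it is defined. Attractor: for a continuous map $T$ on a topological space, a compact set $\mathcal{A}$ with $T(\mathcal{A})\subset\mathcal{A}$ is an attractor for $T$ if there is an open $T$-invariant neighborhood $U\supset\mathcal{A}$ (i.e. $T(U)\subset U$) such that $\bigcap_{n\ge 0}T^n(U)=\mathcal{A}$. "Local" means that $U$ is not required to be the whole space. *)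

theory Defs
  imports "HOL-Analysis.Analysis"
begin

definition SL3 :: "(real^3^3) set" where
  "SL3 = {x. det x = 1}"

fun vertex :: "real^3^3 \<Rightarrow> nat \<Rightarrow> real^3" where
  "vertex x 0 = 0"
| "vertex x (Suc 0) = column 1 x"
| "vertex x (Suc (Suc 0)) = column 2 x"
| "vertex x (Suc (Suc (Suc _))) = column 3 x"

definition regular_tetrahedron :: "real^3^3 \<Rightarrow> bool" where
  "regular_tetrahedron x \<longleftrightarrow>
     (\<exists>l. \<forall>i\<le>3. \<forall>j\<le>3. i \<noteq> j \<longrightarrow> dist (vertex x i) (vertex x j) = l)"

text \<open>The vertex labels of the faces, in the order that determines the cyclic
  indexing of each face: entry \<open>face i ! j\<close> is the label written \<open>i\<close> with subscript \<open>j\<close>.\<close>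

definition face :: "nat \<Rightarrow> nat list" where
  "face i = [[0, 1, 3], [1, 2, 3], [2, 0, 3], [0, 1, 2]] ! i"

definition face_centroid :: "real^3^3 \<Rightarrow> nat \<Rightarrow> real^3" where
  "face_centroid x i = (1/3) *\<^sub>R (\<Sum>j<3. vertex x (face i ! j))"

text \<open>The predecessor of \<open>j\<close> modulo 3 is written \<open>(j + 2) mod 3\<close>, as subtraction on
  \<^typ>\<open>nat\<close> truncates. The denominator is nonzero for every non-degenerate tetrahedron.\<close>

definition theta :: "nat \<Rightarrow> nat \<Rightarrow> real^3^3 \<Rightarrow> real^3" where
  "theta i j x =
     (let c = face_centroid x i;
          p = vertex x (face i ! j);
          q = vertex x (face i ! ((j + 2) mod 3))
      in (norm (q - c) / norm (p - c)) *\<^sub>R (p - c) + c)"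

definition Theta_tilde :: "real^3^3 \<Rightarrow> real^3^3" where
  "Theta_tilde x =
     (let s = theta 0 0 x + theta 2 1 x + theta 3 0 x
      in transpose (vector
           [(1/3) *\<^sub>R (theta 0 1 x + theta 1 0 x + theta 3 1 x - s),
            (1/3) *\<^sub>R (theta 1 1 x + theta 2 0 x + theta 3 2 x - s),
            (1/3) *\<^sub>R (theta 0 2 x + theta 1 2 x + theta 2 2 x - s)]))"

text \<open>\<open>Theta\<close> is a partial map on \<^term>\<open>SL3\<close>: its values are meaningful only on
  \<open>Theta_dom\<close>, and the \<open>n\<close>-th iterate is defined at \<open>x\<close> only if all
  earlier iterates lie in \<open>Theta_dom\<close>. For reals \<^term>\<open>root 3\<close> is the odd cube root.\<close>

definition Theta :: "real^3^3 \<Rightarrow> real^3^3" where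
  "Theta x = root 3 (det x / det (Theta_tilde x)) *\<^sub>R Theta_tilde x"

definition Theta_dom :: "(real^3^3) set" where
  "Theta_dom = {x \<in> SL3. invertible (Theta_tilde x)}"

definition SO3_orbit :: "real^3^3 \<Rightarrow> (real^3^3) set" where
  "SO3_orbit x = {\<rho> ** x | \<rho>. rotation_matrix \<rho>}"

text \<open>Attractors of a partial continuous map \<open>T\<close> with domain \<open>D\<close> on the subspace \<open>X\<close>.
  The invariant neighbourhood is open relative to \<open>X\<close> and contained in \<open>D\<close>,
  so that all iterates are defined on it.\<close>

definition local_attractor ::
  "'a::topological_space set \<Rightarrow> 'a set \<Rightarrow> ('a \<Rightarrow> 'a) \<Rightarrow> 'a set \<Rightarrow> bool" where
  "local_attractor X D T A \<longleftrightarrow>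
     D \<subseteq> X \<and> continuous_on D T \<and> T ` D \<subseteq> X \<and>
     compact A \<and> T ` A \<subseteq> A \<and>
     (\<exists>U. openin (top_of_set X) U \<and> A \<subseteq> U \<and> U \<subseteq> D \<and> T ` U \<subseteq> U \<and>
          (\<Inter>n. (T ^^ n) ` U) = A)"

text \<open>Dimension in the sense of topological manifolds, for the subspace topology on \<open>A\<close>;
  the dimension is unambiguous by invariance of domain.\<close>

definition three_dimensional :: "'a::topological_space set \<Rightarrow> bool" where
  "three_dimensional A \<longleftrightarrow> A \<noteq> {} \<and>
     (\<forall>p\<in>A. \<exists>V W. openin (top_of_set A) V \<and> p \<in> V \<and>
        open (W :: (real^3) set) \<and> V homeomorphic W)"

end

theory Submission
  imports Defs
begin

text \<open>
  The squared edge lengths of the new tetrahedron depend only on those of the old one, through a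
  map that is homogeneous of degree one and fixes the equilateral vector. After normalizing the
  total to remove the scale, the derivative of this map at the equilateral point has Euclidean
  operator norm at most \<open>17/18\<close>. Hence the deviation of the normalized squared edge lengths from
  being equal (\<open>spread\<close>) decays geometrically near the orbit of \<open>x_eq\<close>, which is exactly the
  zero set of \<open>spread\<close> in \<open>SL3\<close>. The displacement of \<open>x\<close> under one step is bounded by a
  multiple of its spread, so the iterates form Cauchy sequences with limits in the orbit. The
  orbit is three-dimensional by the Cayley--Rodrigues chart of the rotation group.
\<close>

section \<open>The transformation in terms of squared edge lengths\<close>

type_synonym edges = "real \<times> real \<times> real \<times> real \<times> real \<times> real"

text \<open>The order is e03, e13, e23, e12, e02, e01, with vertex 0 at the origin; all six-tuples
  below follow it.\<close>

definition sq_edges :: "real^3^3 \<Rightarrow> edges" where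
  "sq_edges x =
     ((norm (column 3 x))\<^sup>2, (norm (column 1 x - column 3 x))\<^sup>2, (norm (column 2 x - column 3 x))\<^sup>2,
      (norm (column 1 x - column 2 x))\<^sup>2, (norm (column 2 x))\<^sup>2, (norm (column 1 x))\<^sup>2)"

text \<open>For a face with vertices p, q, r and centroid c the two linear forms are
  \<open>9 |q - c|^2\<close> and \<open>9 |p - c|^2\<close>, so the root is the ratio in
  \<open>theta\<close>, where q precedes p. Of the factor 1/9, one third comes from the centroid and
  one from the averaging in \<open>Theta_tilde\<close>.\<close>

definition shift :: "real \<Rightarrow> real \<Rightarrow> real \<Rightarrow> real" where
  "shift pq pr qr = (1 - sqrt ((2*pq + 2*qr - pr) / (2*pq + 2*pr - qr))) / 9"

text \<open>Column \<open>j\<close> holds the coefficients of the old vertices \<open>x1, x2, x3\<close> in the difference of the new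
  vertices \<open>j\<close> and \<open>0\<close>; the number \<open>sij\<close> belongs to vertex \<open>j\<close> of face \<open>i\<close>.\<close>

definition weights :: "edges \<Rightarrow> real^3^3" where
  "weights = (\<lambda>(e03, e13, e23, e12, e02, e01).
    let s00 = shift e03 e01 e13; s01 = shift e01 e13 e03; s02 = shift e13 e03 e01;
        s10 = shift e13 e12 e23; s11 = shift e12 e23 e13; s12 = shift e23 e13 e12;
        s20 = shift e23 e02 e03; s21 = shift e02 e03 e23; s22 = shift e03 e23 e02;
        s30 = shift e02 e01 e12; s31 = shift e01 e12 e02; s32 = shift e12 e02 e01
    in vector [
       vector [1 - 2*(s01 + s10 + s31) - s00 - s30, s11 + s32 - s00 - s30, s02 + s12 - s00 - s30],
       vector [s10 + s31 - s21 - s30, 1 - 2*(s11 + s20 + s32) - s21 - s30, s12 + s22 - s21 - s30],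
       vector [s01 + s10 - s00 - s21, s11 + s20 - s00 - s21, 1 - 2*(s02 + s12 + s22) - s00 - s21]])"

text \<open>Polarization turns \<open>2 x1 . x2\<close> into \<open>e01 + e02 - e12\<close>, so on
  the edges of a tetrahedron this is the squared norm of a combination of its columns. Arbitrary
  tuples are allowed so that the form can be differentiated on all of R^6.\<close>

fun quad :: "edges \<Rightarrow> real \<Rightarrow> real \<Rightarrow> real \<Rightarrow> real" where
  "quad (e03, e13, e23, e12, e02, e01) u1 u2 u3 =
     u1\<^sup>2 * e01 + u2\<^sup>2 * e02 + u3\<^sup>2 * e03
     + u1 * u2 * (e01 + e02 - e12) + u1 * u3 * (e01 + e03 - e13) + u2 * u3 * (e02 + e03 - e23)"

definition edge_map :: "real^3^3 \<Rightarrow> edges \<Rightarrow> edges" where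
  "edge_map w e =
    (quad e (w$1$3) (w$2$3) (w$3$3),
     quad e (w$1$1 - w$1$3) (w$2$1 - w$2$3) (w$3$1 - w$3$3),
     quad e (w$1$2 - w$1$3) (w$2$2 - w$2$3) (w$3$2 - w$3$3),
     quad e (w$1$1 - w$1$2) (w$2$1 - w$2$2) (w$3$1 - w$3$2),
     quad e (w$1$2) (w$2$2) (w$3$2),
     quad e (w$1$1) (w$2$1) (w$3$1))"

lemma quad_sq_edges:
  "quad (sq_edges x) u1 u2 u3 = (norm (u1 *\<^sub>R column 1 x + u2 *\<^sub>R column 2 x + u3 *\<^sub>R column 3 x))\<^sup>2"
  unfolding sq_edges_def quad.simps power2_norm_eq_inner
  by (simp add: algebra_simps inner_commute power2_eq_square)

lemma column_mult:
  fixes x w :: "real^3^3"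
  shows "column j (x ** w) = w$1$j *\<^sub>R column 1 x + w$2$j *\<^sub>R column 2 x + w$3$j *\<^sub>R column 3 x"
  by (simp add: vec_eq_iff column_def matrix_matrix_mult_def sum_3 mult.commute)

lemma sq_edges_mult: "sq_edges (x ** w) = edge_map w (sq_edges x)"
  unfolding edge_map_def quad_sq_edges
  by (simp add: sq_edges_def column_mult algebra_simps)

lemma scaleR_3: "3 *\<^sub>R u = u + u + u" for u :: "'a::real_vector"
  using scaleR_add_left[of 1 2 u] by (simp add: scaleR_2 add.assoc)

text \<open>With t the ratio of the norms, the left side is p + (1 - t)(c - p), and c - p is a third
  of q + r - 2p. It remains to express t by squared side lengths.\<close>

lemma theta_shift:
  fixes p q r c :: "'a::real_inner"
  assumes "c = (1/3) *\<^sub>R (p + q + r)"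
  shows "(norm (q - c) / norm (p - c)) *\<^sub>R (p - c) + c =
    p + (3 * shift ((norm (p - q))\<^sup>2) ((norm (p - r))\<^sup>2) ((norm (q - r))\<^sup>2)) *\<^sub>R (q + r - 2 *\<^sub>R p)"
proof -
  have c: "3 *\<^sub>R c = p + q + r" using assms by simp
  \<comment> \<open>The median formula: u - c is two thirds of a median of the triangle u, v,
    w.\<close>
  have *: "9 * (norm (u - c))\<^sup>2 = 2 * (norm (u - v))\<^sup>2 + 2 * (norm (u - w))\<^sup>2 - (norm (v - w))\<^sup>2"
    if "3 *\<^sub>R c = u + v + w" for u v w
  proof -
    have "9 * (norm (u - c))\<^sup>2 = (norm (3 *\<^sub>R (u - c)))\<^sup>2"
      by (simp only: norm_scaleR power_mult_distrib) simp
    also have "3 *\<^sub>R (u - c) = 2 *\<^sub>R u - v - w"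
      by (simp only: scaleR_diff_right that) (simp add: scaleR_2 scaleR_3 algebra_simps)
    finally show ?thesis
      unfolding power2_norm_eq_inner by (simp add: algebra_simps inner_commute)
  qed
  have Q: "9 * (norm (q - c))\<^sup>2 = 2*(norm (p - q))\<^sup>2 + 2*(norm (q - r))\<^sup>2 - (norm (p - r))\<^sup>2"
    using *[of q p r] c by (simp add: norm_minus_commute algebra_simps)
  have P: "9 * (norm (p - c))\<^sup>2 = 2*(norm (p - q))\<^sup>2 + 2*(norm (p - r))\<^sup>2 - (norm (q - r))\<^sup>2"
    using *[of p q r] c by (simp add: norm_minus_commute algebra_simps)
  have "norm (q - c) / norm (p - c) = sqrt ((9 * (norm (q - c))\<^sup>2) / (9 * (norm (p - c))\<^sup>2))"
    by (simp add: real_sqrt_divide)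
  then have t: "norm (q - c) / norm (p - c) =
      1 - 9 * shift ((norm (p - q))\<^sup>2) ((norm (p - r))\<^sup>2) ((norm (q - r))\<^sup>2)"
    unfolding Q P shift_def by (simp add: diff_divide_distrib)
  have qr: "q + r - 2 *\<^sub>R p = 3 *\<^sub>R (c - p)"
    unfolding scaleR_diff_right c by (simp add: scaleR_2 scaleR_3 algebra_simps)
  show ?thesis unfolding t qr
    by (simp add: algebra_simps)
qed

lemma column_transpose_vector:
  "column 1 (transpose (vector [a, b, c]) :: real^3^3) = a"
  "column 2 (transpose (vector [a, b, c]) :: real^3^3) = b"
  "column 3 (transpose (vector [a, b, c]) :: real^3^3) = c"
  by (simp_all add: column_transpose row_def vec_eq_iff)

lemma bounded_bilinear_matrix_mult: "bounded_bilinear ((**) :: real^3^3 \<Rightarrow> real^3^3 \<Rightarrow> real^3^3)"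
  unfolding bilinear_conv_bounded_bilinear[symmetric] bilinear_def
  by (auto intro!: linearI simp: vec_eq_iff matrix_matrix_mult_def sum_3 algebra_simps)

lemma matrix_eq_columns:
  fixes x y :: "real^3^3"
  assumes "column 1 x = column 1 y" "column 2 x = column 2 y" "column 3 x = column 3 y"
  shows "x = y"
  using assms unfolding vec_eq_iff column_def by (simp add: forall_3)

lemma vertex_numeral:
  "vertex x 2 = column 2 x" "vertex x 3 = column 3 x" "vertex x 1 = column 1 x"
  by (simp_all add: numeral_eq_Suc)

text \<open>Each new vertex is the mean of three points, each being the old vertex plus a
  combination of the vertices of a face. The coefficients depend on squared edge lengths only, and
  subtracting \<open>s\<close> moves the new vertex 0 to the origin.\<close>

lemma Theta_tilde_eq: "Theta_tilde x = x ** weights (sq_edges x)"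
proof -
  define x1 x2 x3 where x: "x1 = column 1 x" "x2 = column 2 x" "x3 = column 3 x"
  have sum: "(\<Sum>j<3::nat. f j) = f 0 + f 1 + f 2" for f :: "nat \<Rightarrow> real^3"
    by (simp add: numeral_eq_Suc)
  let ?e = "\<lambda>p q. (norm (p - q))\<^sup>2"
  define t where "t p q r = p + (3 * shift (?e p q) (?e p r) (?e q r)) *\<^sub>R (q + r - 2 *\<^sub>R p)"
    for p q r :: "real^3"
  have T: "(norm (q - c) / norm (p - c)) *\<^sub>R (p - c) + c = t p q r"
    if "c = (1/3) *\<^sub>R (p + q + r)" for c p q r
    unfolding t_def using theta_shift[OF that] .
  \<comment> \<open>The second argument of \<open>t\<close> is the cyclic predecessor, the third the
    remaining vertex; their order matters, as \<open>shift\<close> is not symmetric in them.\<close>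
  have theta: "theta i j x = t (vertex x (face i ! j)) (vertex x (face i ! ((j + 2) mod 3)))
      (vertex x (face i ! ((j + 1) mod 3)))"
    if "j < 3" for i j
  proof -
    have "j = 0 \<or> j = 1 \<or> j = 2" using that by auto
    then show ?thesis
      unfolding theta_def Let_def face_centroid_def sum
      by (elim disjE; intro T; simp add: algebra_simps flip: numeral_2_eq_2)
  qed
  have th: "theta 0 0 x = t 0 x3 x1" "theta 0 1 x = t x1 0 x3" "theta 0 2 x = t x3 x1 0"
    "theta 1 0 x = t x1 x3 x2" "theta 1 1 x = t x2 x1 x3" "theta 1 2 x = t x3 x2 x1"
    "theta 2 0 x = t x2 x3 0" "theta 2 1 x = t 0 x2 x3" "theta 2 2 x = t x3 0 x2"
    "theta 3 0 x = t 0 x2 x1" "theta 3 1 x = t x1 0 x2" "theta 3 2 x = t x2 x1 0"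
    by (simp_all add: theta face_def x vertex_numeral)
  let ?s = "\<lambda>p q r. shift (?e p q) (?e p r) (?e q r)"
  \<comment> \<open>Opaque names for the twelve coefficients leave polynomial identities without
    roots to \<open>algebra\<close>.\<close>
  define s00 where "s00 = ?s 0 x3 x1"
  define s01 where "s01 = ?s x1 0 x3"
  define s02 where "s02 = ?s x3 x1 0"
  define s10 where "s10 = ?s x1 x3 x2"
  define s11 where "s11 = ?s x2 x1 x3"
  define s12 where "s12 = ?s x3 x2 x1"
  define s20 where "s20 = ?s x2 x3 0"
  define s21 where "s21 = ?s 0 x2 x3"
  define s22 where "s22 = ?s x3 0 x2"
  define s30 where "s30 = ?s 0 x2 x1"
  define s31 where "s31 = ?s x1 0 x2"
  define s32 where "s32 = ?s x2 x1 0"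
  note s = s00_def s01_def s02_def s10_def s11_def s12_def s20_def s21_def s22_def s30_def s31_def s32_def
  have W: "weights (sq_edges x) = vector [
       vector [1 - 2*(s01 + s10 + s31) - s00 - s30, s11 + s32 - s00 - s30, s02 + s12 - s00 - s30],
       vector [s10 + s31 - s21 - s30, 1 - 2*(s11 + s20 + s32) - s21 - s30, s12 + s22 - s21 - s30],
       vector [s01 + s10 - s00 - s21, s11 + s20 - s00 - s21, 1 - 2*(s02 + s12 + s22) - s00 - s21]]"
    unfolding s sq_edges_def weights_def Let_def prod.case by (simp add: x norm_minus_commute)
  note comps = vec_eq_iff vector_add_component vector_minus_component vector_scaleR_component
    zero_index real_scaleR_def
  show ?thesis
    unfolding Theta_tilde_def Let_def th t_def
    unfolding s[symmetric]
    by (rule matrix_eq_columns;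
        unfold column_transpose_vector column_mult W vector_3 x[symmetric]; unfold comps; intro allI;
        algebra)
qed

text \<open>Every \<open>shift\<close> sees its arguments only through a quotient of two linear
  forms.\<close>

lemma weights_scale: "c > 0 \<Longrightarrow> weights (c *\<^sub>R e) = weights e"
proof -
  assume c: "c > 0"
  have *: "shift (c * p) (c * q) (c * r) = shift p q r" for p q r
  proof -
    have "(2*(c*p) + 2*(c*r) - c*q) / (2*(c*p) + 2*(c*q) - c*r) = (c * (2*p + 2*r - q)) / (c * (2*p + 2*q - r))"
      by (simp add: algebra_simps)
    also have "\<dots> = (2*p + 2*r - q) / (2*p + 2*q - r)" using c by simp
    finally show ?thesis unfolding shift_def by presburger
  qed
  show ?thesis by (cases e) (simp only: weights_def scaleR_Pair real_scaleR_def prod.case *)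
qed

lemma quad_scale: "quad (c *\<^sub>R e) u v w = c * quad e u v w"
  by (cases e) (simp add: algebra_simps)

lemma edge_map_scale: "edge_map w (c *\<^sub>R e) = c *\<^sub>R edge_map w e"
  by (simp add: edge_map_def quad_scale)

lemma quad_scaleR_coefficients: "quad e (c * u) (c * v) (c * w) = c\<^sup>2 * quad e u v w"
  by (cases e) (simp add: algebra_simps power2_eq_square)

lemma edge_map_scaleR_matrix: "edge_map (c *\<^sub>R w) e = c\<^sup>2 *\<^sub>R edge_map w e"
  by (simp add: edge_map_def flip: right_diff_distrib quad_scaleR_coefficients)

section \<open>Contraction at the equilateral point\<close>

definition unit_edges :: edges where "unit_edges = (1, 1, 1, 1, 1, 1)"

fun edge_sum :: "edges \<Rightarrow> real" where
  "edge_sum (e03, e13, e23, e12, e02, e01) = e03 + e13 + e23 + e12 + e02 + e01"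

text \<open>The total is set to 6 so that every positive multiple of \<open>unit_edges\<close>
  normalizes to \<open>unit_edges\<close>.\<close>

definition normalized :: "edges \<Rightarrow> edges" where
  "normalized e = (6 / edge_sum e) *\<^sub>R e"

definition edge_step :: "edges \<Rightarrow> edges" where
  "edge_step e = edge_map (weights e) e"

text \<open>Both linear forms equal 3 at the equilateral point, so their quotient has derivative r'
  - q'. The square root halves this, and the factor -1/9 gives the rest.\<close>

lemma has_derivative_shift:
  assumes "(p has_derivative p') (at z)" "(q has_derivative q') (at z)" "(r has_derivative r') (at z)"
    and "p z = 1" "q z = 1" "r z = 1"
  shows "((\<lambda>z. shift (p z) (q z) (r z)) has_derivative (\<lambda>h. (q' h - r' h) / 18)) (at z)"
  unfolding shift_def
  by (rule derivative_eq_intros assms refl | simp add: assms)+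
     (auto simp: fun_eq_iff field_simps)

definition weights_derivative :: "edges \<Rightarrow> real^3^3" where
  "weights_derivative = (\<lambda>(e03, e13, e23, e12, e02, e01).
    let s00 = (e01 - e13) / 18; s01 = (e13 - e03) / 18; s02 = (e03 - e01) / 18;
        s10 = (e12 - e23) / 18; s11 = (e23 - e13) / 18; s12 = (e13 - e12) / 18;
        s20 = (e02 - e03) / 18; s21 = (e03 - e23) / 18; s22 = (e23 - e02) / 18;
        s30 = (e01 - e12) / 18; s31 = (e12 - e02) / 18; s32 = (e02 - e01) / 18
    in vector [
       vector [- 2*(s01 + s10 + s31) - s00 - s30, s11 + s32 - s00 - s30, s02 + s12 - s00 - s30],
       vector [s10 + s31 - s21 - s30, - 2*(s11 + s20 + s32) - s21 - s30, s12 + s22 - s21 - s30],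
       vector [s01 + s10 - s00 - s21, s11 + s20 - s00 - s21, - 2*(s02 + s12 + s22) - s00 - s21]])"

lemma has_derivative_weights_nth:
  "((\<lambda>e. weights e $ i $ j) has_derivative (\<lambda>h. weights_derivative h $ i $ j)) (at unit_edges)"
proof -
  have "\<forall>i j. ((\<lambda>e. weights e $ i $ j) has_derivative (\<lambda>h. weights_derivative h $ i $ j)) (at unit_edges)"
    unfolding forall_3 weights_def weights_derivative_def Let_def split_beta vector_3
    by (intro conjI)
       (rule derivative_eq_intros has_derivative_shift refl | simp add: unit_edges_def)+
  then show ?thesis by blast
qed

text \<open>The form is linear in \<open>e\<close>, which yields the term
  \<open>quad h a b c\<close>. At \<open>unit_edges\<close> it is the polynomial u^2 + v^2 + w^2 +
  uv + uw + vw, whose partial derivatives are the three other coefficients.\<close>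

lemma has_derivative_quad:
  fixes u v w :: "edges \<Rightarrow> real"
  assumes "(u has_derivative u') (at unit_edges)" "(v has_derivative v') (at unit_edges)"
    "(w has_derivative w') (at unit_edges)"
    and "u unit_edges = a" "v unit_edges = b" "w unit_edges = c"
  shows "((\<lambda>e. quad e (u e) (v e) (w e)) has_derivative
    (\<lambda>h. quad h a b c + (2*a + b + c) * u' h + (a + 2*b + c) * v' h + (a + b + 2*c) * w' h)) (at unit_edges)"
proof -
  have q: "quad e x y z = x\<^sup>2 * snd (snd (snd (snd (snd e)))) + y\<^sup>2 * fst (snd (snd (snd (snd e)))) + z\<^sup>2 * fst e
     + x * y * (snd (snd (snd (snd (snd e)))) + fst (snd (snd (snd (snd e)))) - fst (snd (snd (snd e))))
     + x * z * (snd (snd (snd (snd (snd e)))) + fst e - fst (snd e))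
     + y * z * (fst (snd (snd (snd (snd e)))) + fst e - fst (snd (snd e)))" for e x y z
    by (cases e) simp
  show ?thesis
    unfolding q
    by (rule derivative_eq_intros assms(1-3) refl)+
       (simp add: unit_edges_def[symmetric] assms(4-) fun_eq_iff,
        simp add: unit_edges_def algebra_simps power2_eq_square)
qed

lemma weights_unit: "weights unit_edges = mat 1"
  by (simp add: weights_def unit_edges_def shift_def vec_eq_iff mat_def forall_3)

text \<open>The letters stand for e03, e13, e23, e12, e02, e01. The integer coefficients of each
  entry sum to 18, so \<open>unit_edges\<close> is fixed, as Euler's relation demands of a map of
  degree one fixing that point.\<close>

definition edge_step_derivative :: "edges \<Rightarrow> edges" where
  "edge_step_derivative = (\<lambda>(a, b, c, d, f, g). (1/18) *\<^sub>R
    (12*a + b + 4*d + 3*f - 2*g, 12*b + c - 2*d + 4*f + 3*g, a + 12*c + 3*d - 2*f + 4*g,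
     4*a + b + 12*d - 2*f + 3*g, 4*b + c + 3*d + 12*f - 2*g, a + 4*c - 2*d + 3*f + 12*g))"

text \<open>Since \<open>weights\<close> is the identity matrix at \<open>unit_edges\<close>, the
  derivative is \<open>h\<close> itself plus the effect of \<open>weights_derivative h\<close> on
  the equilateral form.\<close>

lemma has_derivative_edge_step: "(edge_step has_derivative edge_step_derivative) (at unit_edges)"
proof -
  have [simp]: "weights unit_edges $ i $ j = (if i = j then 1 else 0)" for i j
    by (simp add: weights_unit mat_def)
  note d = has_derivative_weights_nth
  show ?thesis
    unfolding edge_step_def edge_map_def
    by (rule has_derivative_eq_rhs,
        (rule has_derivative_Pair has_derivative_quad has_derivative_diff d refl)+)
       (simp add: fun_eq_iff edge_step_derivative_def weights_derivative_def Let_def field_simps)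
qed

lemma edge_sum_eq: "edge_sum e = fst e + fst (snd e) + fst (snd (snd e)) + fst (snd (snd (snd e)))
   + fst (snd (snd (snd (snd e)))) + snd (snd (snd (snd (snd e))))"
  by (cases e) simp

lemma bounded_linear_edge_sum: "bounded_linear edge_sum"
  unfolding edge_sum_eq [abs_def]
  by (intro bounded_linear_add bounded_linear_fst bounded_linear_snd
      bounded_linear_fst_comp bounded_linear_snd_comp)

text \<open>The derivative is the orthogonal projection onto the tuples with sum zero.\<close>

lemma has_derivative_normalized:
  "(normalized has_derivative (\<lambda>h. h - (edge_sum h / 6) *\<^sub>R unit_edges)) (at unit_edges)"
proof -
  have t: "edge_sum unit_edges = 6" by (simp add: unit_edges_def)
  show ?thesis
    unfolding normalized_def
    by (rule derivative_eq_intros bounded_linear.has_derivative[OF bounded_linear_edge_sum] refl | simp add: t)+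
qed

lemma edge_step_unit: "edge_step unit_edges = unit_edges"
  unfolding edge_step_def edge_map_def weights_unit by (simp add: mat_def unit_edges_def)

lemma normalized_unit: "normalized unit_edges = unit_edges"
  by (simp add: normalized_def unit_edges_def)

lemma norm_edges: "(norm ((a, b, c, d, f, g) :: edges))\<^sup>2 = a\<^sup>2 + b\<^sup>2 + c\<^sup>2 + d\<^sup>2 + f\<^sup>2 + g\<^sup>2"
  by (simp add: norm_Pair)

text \<open>The projection kills the direction \<open>unit_edges\<close>, on which
  \<open>edge_step_derivative\<close> is the identity; without it no contraction would be
  possible.\<close>

definition step_derivative :: "edges \<Rightarrow> edges" where
  "step_derivative h = edge_step_derivative h - (edge_sum (edge_step_derivative h) / 6) *\<^sub>R unit_edges"

lemma has_derivative_step: "((\<lambda>e. normalized (edge_step e)) has_derivative step_derivative) (at unit_edges)"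
  using has_derivative_compose[OF has_derivative_edge_step, of normalized] has_derivative_normalized
  unfolding edge_step_unit step_derivative_def[abs_def] by blast

text \<open>The squares come from the $LDL^T$ decomposition of the quadratic form
  \<open>289 |h|^2 - |18 dh|^2\<close>, where \<open>dh\<close> is the derivative applied to \<open>h\<close> and \<open>289 = 17^2\<close>.\<close>

lemma norm_step_derivative: "norm (step_derivative h) \<le> 17/18 * norm h"
proof -
  obtain a b c d f g where h: "h = (a, b, c, d, f, g)" by (cases h)
  have e: "18 *\<^sub>R step_derivative h = (9*a - 2*b - 3*c + d - 5*g, 9*b - 3*a - 2*c - 5*d + f, 9*c - 2*a - 3*b - 5*f + g,
      a - 2*b - 3*c + 9*d - 5*f, b - 3*a - 2*c + 9*f - 5*g, c - 2*a - 3*b - 5*d + 9*g)"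
    by (simp add: h step_derivative_def edge_step_derivative_def unit_edges_def field_simps)
  have "289 * (norm h)\<^sup>2 - (norm (18 *\<^sub>R step_derivative h))\<^sup>2 =
     181 * (a + 38/181*b + 38/181*c - 43/181*d + 25/181*f + 50/181*g)\<^sup>2
     + 31317/181 * (b + 38/219*c + 10684/31317*d - 2911/10439*f + 875/10439*g)\<^sup>2
     + 36751/219 * (c + 5209/36751*d + 11634/36751*f - 12267/36751*g)\<^sup>2
     + 4530501/36751 * (d + 264893/503389*f + 264893/503389*g)\<^sup>2
     + 6416691264/71984627 * (f + 264893/768282*g)\<^sup>2
     + 10057200/128047 * g\<^sup>2"
    unfolding e unfolding h norm_edges by algebra
  also have "\<dots> \<ge> 0" by (intro add_nonneg_nonneg mult_nonneg_nonneg) auto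
  finally have "(norm (18 *\<^sub>R step_derivative h))\<^sup>2 \<le> (17 * norm h)\<^sup>2" by (simp add: power_mult_distrib)
  then have "norm (18 *\<^sub>R step_derivative h) \<le> 17 * norm h" by (rule power2_le_imp_le) simp
  then show ?thesis by simp
qed

lemma step_contraction:
  obtains \<delta> where "\<delta> > 0"
    "\<And>e. norm (e - unit_edges) < \<delta> \<Longrightarrow>
      norm (normalized (edge_step e) - unit_edges) \<le> 35/36 * norm (e - unit_edges)"
proof -
  \<comment> \<open>The tolerance 1/36 is half of the gap between 17/18 and 1, which makes the
    contraction factor 35/36.\<close>
  obtain \<delta> where \<delta>: "\<delta> > 0" "\<And>e. norm (e - unit_edges) < \<delta> \<Longrightarrow>
     norm (normalized (edge_step e) - normalized (edge_step unit_edges) - step_derivative (e - unit_edges)) \<le> 1/36 * norm (e - unit_edges)"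
    using has_derivative_step[unfolded has_derivative_at_alt] by (metis zero_less_divide_1_iff zero_less_numeral)
  have "norm (normalized (edge_step e) - unit_edges) \<le> 35/36 * norm (e - unit_edges)"
    if "norm (e - unit_edges) < \<delta>" for e
  proof -
    have "norm (normalized (edge_step e) - unit_edges - step_derivative (e - unit_edges)) \<le> 1/36 * norm (e - unit_edges)"
      using \<delta>(2)[OF that] by (simp add: edge_step_unit normalized_unit)
    moreover have "norm (normalized (edge_step e) - unit_edges)
       \<le> norm (step_derivative (e - unit_edges)) + norm (normalized (edge_step e) - unit_edges - step_derivative (e - unit_edges))"
      by (rule norm_triangle_sub)
    ultimately show ?thesis using norm_step_derivative[of "e - unit_edges"] by linarith
  qed
  with \<delta>(1) show ?thesis using that by blast
qed

section \<open>The spread of a tetrahedron\<close>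

lemma edge_sum_scale: "edge_sum (c *\<^sub>R e) = c * edge_sum e"
  by (cases e) (simp add: algebra_simps)

lemma normalized_scale: "c \<noteq> 0 \<Longrightarrow> normalized (c *\<^sub>R e) = normalized e"
  by (simp add: normalized_def edge_sum_scale)

lemma edge_step_scale: "c > 0 \<Longrightarrow> edge_step (c *\<^sub>R e) = c *\<^sub>R edge_step e"
  by (simp add: edge_step_def weights_scale edge_map_scale)

lemma normalized_eq: "edge_sum e \<noteq> 0 \<Longrightarrow> e = (edge_sum e / 6) *\<^sub>R normalized e"
  by (simp add: normalized_def)

text \<open>The Gram matrix of the columns, with off-diagonal entries by polarization. As a function
  of arbitrary tuples its determinant is continuous near \<open>unit_edges\<close>, and it controls
  the size of a tetrahedron of determinant one.\<close>

definition gram :: "edges \<Rightarrow> real^3^3" where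
  "gram = (\<lambda>(e03, e13, e23, e12, e02, e01). vector [
     vector [e01, (e01 + e02 - e12) / 2, (e01 + e03 - e13) / 2],
     vector [(e01 + e02 - e12) / 2, e02, (e02 + e03 - e23) / 2],
     vector [(e01 + e03 - e13) / 2, (e02 + e03 - e23) / 2, e03]])"

lemma gram_sq_edges: "transpose x ** x = gram (sq_edges x)"
proof -
  have "(transpose x ** x) $ i $ j = column i x \<bullet> column j x" for i j
    by (simp add: matrix_mult_transpose_dot_column)
  moreover have "\<forall>i j. column i x \<bullet> column j x = gram (sq_edges x) $ i $ j"
    unfolding gram_def sq_edges_def power2_norm_eq_inner
    by (simp add: forall_3 inner_diff inner_commute)
  ultimately show ?thesis by (simp add: vec_eq_iff)
qed

lemma gram_scale: "gram (c *\<^sub>R e) = c *\<^sub>R gram e"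
  by (cases e) (simp add: gram_def vec_eq_iff forall_3 algebra_simps)

lemma det_scaleR3: "det (c *\<^sub>R x) = c ^ 3 * det (x :: real^3^3)"
  by (simp add: det_3 algebra_simps power3_eq_cube)

lemma det_gram_sq_edges: "det (gram (sq_edges x)) = (det x)\<^sup>2"
  by (simp add: det_mul det_transpose power2_eq_square flip: gram_sq_edges)

lemma det_gram_unit: "det (gram unit_edges) = 1/2"
  by (simp add: gram_def unit_edges_def det_3)

lemma continuous_on_det: "continuous_on S (det :: real^3^3 \<Rightarrow> real)"
  unfolding det_3[abs_def] by (intro continuous_intros)

lemma continuous_on_gram: "continuous_on S (\<lambda>e. det (gram e))"
  unfolding gram_def split_beta det_3 by (simp, intro continuous_intros) auto

lemma continuous_on_sq_edges: "continuous_on S sq_edges"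
  unfolding sq_edges_def[abs_def] column_def by (intro continuous_intros)

lemma norm_matrix_sq: "(norm (x :: real^3^3))\<^sup>2 = (norm (column 1 x))\<^sup>2 + (norm (column 2 x))\<^sup>2 + (norm (column 3 x))\<^sup>2"
  unfolding power2_norm_eq_inner by (simp add: inner_vec_def sum_3 column_def)

lemma edge_sum_sq_edges: "(norm x)\<^sup>2 \<le> edge_sum (sq_edges x)"
  unfolding norm_matrix_sq sq_edges_def by simp

lemma edge_sum_sq_edges_pos: "x \<in> SL3 \<Longrightarrow> edge_sum (sq_edges x) > 0"
proof -
  assume "x \<in> SL3"
  then have "x \<noteq> 0" by (auto simp: SL3_def det_3)
  then have "0 < (norm x)\<^sup>2" by simp
  then show ?thesis using edge_sum_sq_edges[of x] by linarith
qed

definition spread :: "real^3^3 \<Rightarrow> real" where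
  "spread x = norm (normalized (sq_edges x) - unit_edges)"

lemma continuous_on_spread: "continuous_on SL3 spread"
  unfolding spread_def[abs_def] normalized_def
  by (intro continuous_intros continuous_on_sq_edges
      bounded_linear.continuous_on[OF bounded_linear_edge_sum])
     (use edge_sum_sq_edges_pos in force)

text \<open>Determinant one fixes the scale: the normalized Gram determinant times s^3 equals 1,
  where s is the mean squared edge length. So a normalized shape away from degeneracy bounds
  \<open>x\<close>.\<close>

lemma norm_bounded_of_gram:
  assumes "x \<in> SL3" "det (gram (normalized (sq_edges x))) > 1/4"
  shows "norm x \<le> 4"
proof -
  define s where "s = edge_sum (sq_edges x) / 6"
  have s: "s > 0" "sq_edges x = s *\<^sub>R normalized (sq_edges x)"
    using edge_sum_sq_edges_pos[OF assms(1)] normalized_eq[of "sq_edges x"] by (auto simp: s_def)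
  have "1 = det (gram (sq_edges x))" using assms(1) by (simp add: det_gram_sq_edges SL3_def)
  also have "\<dots> = s ^ 3 * det (gram (normalized (sq_edges x)))"
    by (subst s(2)) (simp only: gram_scale det_scaleR3)
  \<comment> \<open>The threshold 1/4 is half of \<open>det (gram unit_edges)\<close>. It gives s^3
    at most 4, hence s at most 2 and an edge sum of at most 12, which is below 4^2.\<close>
  finally have "s ^ 3 * (1/4) \<le> 1" using assms(2) s(1)
    by (metis less_eq_real_def mult_left_mono zero_le_power)
  then have "s ^ 3 \<le> 2 ^ 3" by simp
  then have "s \<le> 2" using power_strict_mono[of 2 s 3] by force
  then have "(norm x)\<^sup>2 \<le> 4\<^sup>2" using edge_sum_sq_edges[of x] by (simp add: s_def)
  then show ?thesis by (rule power2_le_imp_le) simp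
qed

section \<open>The transformation as right multiplication by a matrix near the identity\<close>

definition step_matrix :: "edges \<Rightarrow> real^3^3" where
  "step_matrix e = (1 / root 3 (det (weights e))) *\<^sub>R weights e"

lemma matrix_mult_scaleR: "x ** (c *\<^sub>R w) = c *\<^sub>R (x ** w)" for x w :: "real^3^3"
  by (rule bounded_bilinear.scaleR_right[OF bounded_bilinear_matrix_mult])

text \<open>Scale invariance of \<open>weights\<close> makes the multiplier a function of the
  normalized edges alone, so its distance from the identity can be estimated by
  \<open>spread x\<close>.\<close>

lemma Theta_eq: "x \<in> SL3 \<Longrightarrow> Theta x = x ** step_matrix (normalized (sq_edges x))"
proof -
  assume x: "x \<in> SL3"
  have "weights (normalized (sq_edges x)) = weights (sq_edges x)"
    unfolding normalized_def using edge_sum_sq_edges_pos[OF x] by (intro weights_scale) simp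
  then show ?thesis using x
    by (simp add: Theta_def Theta_tilde_eq step_matrix_def matrix_mult_scaleR SL3_def det_mul real_root_divide)
qed

lemma Theta_mem_SL3: "x \<in> Theta_dom \<Longrightarrow> Theta x \<in> SL3"
  by (auto simp: Theta_dom_def SL3_def Theta_def det_scaleR3 invertible_det_nz odd_real_root_pow)

text \<open>The cube root factor multiplies all squared edges by the same number, which
  normalization removes. Normalizing before the step changes nothing either, because
  \<open>edge_step\<close> is homogeneous.\<close>

lemma spread_Theta:
  assumes "x \<in> Theta_dom"
  shows "spread (Theta x) = norm (normalized (edge_step (normalized (sq_edges x))) - unit_edges)"
proof -
  have x: "x \<in> SL3" "det (Theta_tilde x) \<noteq> 0"
    using assms by (auto simp: Theta_dom_def invertible_det_nz)
  define c where "c = root 3 (det x / det (Theta_tilde x))"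
  have c: "c \<noteq> 0" using x by (simp add: c_def SL3_def)
  have e: "sq_edges (Theta x) = c\<^sup>2 *\<^sub>R edge_step (sq_edges x)"
    by (simp add: Theta_def Theta_tilde_eq sq_edges_mult edge_map_scaleR_matrix edge_step_def c_def flip: matrix_mult_scaleR)
  have t: "edge_sum (sq_edges x) > 0" using edge_sum_sq_edges_pos[OF x(1)] .
  have "normalized (edge_step (normalized (sq_edges x))) = normalized (edge_step (sq_edges x))"
    using t unfolding normalized_def[of "sq_edges x"]
    by (subst edge_step_scale) (auto simp: normalized_scale)
  then show ?thesis using c unfolding spread_def e by (simp add: normalized_scale)
qed

lemma differentiable_imp_locally_Lipschitz:
  fixes f :: "'a::real_normed_vector \<Rightarrow> 'b::real_normed_vector"
  assumes "f differentiable (at a)"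
  obtains \<delta> C where "\<delta> > 0" "C > 0" "\<And>y. norm (y - a) < \<delta> \<Longrightarrow> norm (f y - f a) \<le> C * norm (y - a)"
proof -
  obtain f' where f': "(f has_derivative f') (at a)" using assms by (auto simp: differentiable_def)
  then obtain K where K: "K > 0" "\<And>h. norm (f' h) \<le> norm h * K"
    using bounded_linear.pos_bounded[OF has_derivative_bounded_linear] by blast
  obtain \<delta> where \<delta>: "\<delta> > 0" "\<And>y. norm (y - a) < \<delta> \<Longrightarrow> norm (f y - f a - f' (y - a)) \<le> 1 * norm (y - a)"
    using f'[unfolded has_derivative_at_alt] by (metis zero_less_one)
  \<comment> \<open>The linear part contributes K, the remainder 1.\<close>
  have "norm (f y - f a) \<le> (K + 1) * norm (y - a)" if "norm (y - a) < \<delta>" for y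
    using \<delta>(2)[OF that] K(2)[of "y - a"] norm_triangle_sub[of "f y - f a" "f' (y - a)"]
    by (simp add: algebra_simps)
  with \<delta>(1) K(1) show ?thesis using that[of \<delta> "K + 1"] by auto
qed

lemma differentiable_matrix:
  fixes f :: "'a::real_normed_vector \<Rightarrow> real^3^3"
  assumes "\<And>i j. (\<lambda>e. f e $ i $ j) differentiable (at a)"
  shows "f differentiable (at a)"
  by (subst differentiable_componentwise_within) (auto simp: Basis_vec_def inner_axis assms)

lemma differentiable_weights: "weights differentiable (at unit_edges)"
  using has_derivative_weights_nth by (intro differentiable_matrix) (auto simp: differentiable_def)

lemma differentiable_det_weights: "(\<lambda>e. det (weights e)) differentiable (at unit_edges)"
proof -
  have "(\<lambda>e. weights e $ i $ j) differentiable (at unit_edges)" for i j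
    using has_derivative_weights_nth by (auto simp: differentiable_def)
  then show ?thesis unfolding det_3 by simp
qed

text \<open>The cube root is differentiable away from 0, and its argument is 1 at
  \<open>unit_edges\<close>.\<close>

lemma differentiable_step_matrix: "step_matrix differentiable (at unit_edges)"
proof -
  have "root 3 differentiable (at (det (weights unit_edges)))"
    using DERIV_real_root[of 3 1] by (auto simp: weights_unit real_differentiable_def)
  then have "(\<lambda>e. root 3 (det (weights e))) differentiable (at unit_edges)"
    using differentiable_chain_at[OF differentiable_det_weights, of "root 3"] by (simp add: o_def)
  then show ?thesis unfolding step_matrix_def[abs_def]
    by (intro differentiable_scaleR differentiable_weights differentiable_divide) (auto simp: weights_unit)
qed

lemma step_matrix_unit: "step_matrix unit_edges = mat 1"
  by (simp add: step_matrix_def weights_unit)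

lemma eventually_nhds_norm:
  "(\<forall>\<^sub>F e in nhds a. P e) \<longleftrightarrow> (\<exists>\<delta>>0. \<forall>e. norm (e - a) < \<delta> \<longrightarrow> P e)" for a :: "'a::real_normed_vector"
  by (simp add: eventually_nhds_metric dist_norm)

text \<open>Four neighbourhoods of \<open>unit_edges\<close> are intersected: \<open>d1\<close>
  gives contraction, \<open>d2\<close> a Lipschitz bound for \<open>step_matrix\<close>,
  \<open>d3\<close> a bound on \<open>norm x\<close>, and \<open>d4\<close> invertibility of
  \<open>Theta_tilde x\<close>.\<close>

lemma basin_exists:
  obtains \<delta> C where "\<delta> > 0" "C > 0"
    "\<And>x. x \<in> SL3 \<Longrightarrow> spread x < \<delta> \<Longrightarrow> x \<in> Theta_dom"
    "\<And>x. x \<in> SL3 \<Longrightarrow> spread x < \<delta> \<Longrightarrow> spread (Theta x) \<le> 35/36 * spread x"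
    "\<And>x. x \<in> SL3 \<Longrightarrow> spread x < \<delta> \<Longrightarrow> norm (Theta x - x) \<le> C * spread x"
proof -
  obtain d1 where d1: "d1 > 0" "\<And>e. norm (e - unit_edges) < d1 \<Longrightarrow>
      norm (normalized (edge_step e) - unit_edges) \<le> 35/36 * norm (e - unit_edges)"
    using step_contraction by blast
  obtain d2 C where d2: "d2 > 0" "C > 0" "\<And>e. norm (e - unit_edges) < d2 \<Longrightarrow>
      norm (step_matrix e - mat 1) \<le> C * norm (e - unit_edges)"
    using differentiable_imp_locally_Lipschitz[OF differentiable_step_matrix] unfolding step_matrix_unit by metis
  have "isCont (\<lambda>e. det (gram e)) unit_edges"
    using continuous_on_gram[of UNIV] by (simp add: continuous_on_eq_continuous_at del: split_paired_All)
  then have "((\<lambda>e. det (gram e)) \<longlongrightarrow> det (gram unit_edges)) (nhds unit_edges)"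
    using tendsto_at_iff_tendsto_nhds[of "\<lambda>e. det (gram e)"] by (simp only: isCont_def)
  from order_tendstoD(1)[OF this, of "1/4"]
  have "\<forall>\<^sub>F e in nhds unit_edges. det (gram e) > 1/4" by (simp add: det_gram_unit)
  then obtain d3 where d3: "d3 > 0" "\<And>e. norm (e - unit_edges) < d3 \<Longrightarrow> det (gram e) > 1/4"
    unfolding eventually_nhds_norm by blast
  have "isCont (\<lambda>e. det (weights e)) unit_edges"
    using differentiable_det_weights by (rule differentiable_imp_continuous_within)
  then have "((\<lambda>e. det (weights e)) \<longlongrightarrow> det (weights unit_edges)) (nhds unit_edges)"
    using tendsto_at_iff_tendsto_nhds[of "\<lambda>e. det (weights e)"] by (simp only: isCont_def)
  from order_tendstoD(1)[OF this, of 0]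
  have "\<forall>\<^sub>F e in nhds unit_edges. det (weights e) > 0" by (simp add: weights_unit)
  then obtain d4 where d4: "d4 > 0" "\<And>e. norm (e - unit_edges) < d4 \<Longrightarrow> det (weights e) > 0"
    unfolding eventually_nhds_norm by blast
  have "\<exists>K>0. \<forall>(x::real^3^3) (w::real^3^3). norm (x ** w) \<le> norm x * norm w * K"
    by (rule bounded_bilinear.pos_bounded[OF bounded_bilinear_matrix_mult])
  then obtain K where "K > 0 \<and> (\<forall>(x::real^3^3) (w::real^3^3). norm (x ** w) \<le> norm x * norm w * K)" ..
  then have K: "K > 0" "norm (x ** w) \<le> norm x * norm w * K" for x w :: "real^3^3" by simp_all
  define d where "d = Min {d1, d2, d3, d4}"
  have d: "d > 0" "d \<le> d1" "d \<le> d2" "d \<le> d3" "d \<le> d4"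
    using d1 d2 d3 d4 by (auto simp: d_def)
  show ?thesis
  \<comment> \<open>In the displacement constant, 4 bounds \<open>norm x\<close>, \<open>C\<close>
    is the Lipschitz constant of \<open>step_matrix\<close>, and \<open>K\<close> the constant of
    matrix multiplication.\<close>
  proof (rule that[of d "4 * C * K"])
    fix x assume x: "x \<in> SL3" and s: "spread x < d"
    define e where "e = normalized (sq_edges x)"
    have e: "norm (e - unit_edges) = spread x" by (simp add: e_def spread_def)
    have "weights e = weights (sq_edges x)"
      unfolding e_def normalized_def using edge_sum_sq_edges_pos[OF x] by (intro weights_scale) simp
    then have "det (weights (sq_edges x)) > 0" using d4(2)[of e] e s d by simp
    then show dom: "x \<in> Theta_dom"
      using x by (simp add: Theta_dom_def Theta_tilde_eq invertible_det_nz det_mul SL3_def)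
    show "spread (Theta x) \<le> 35/36 * spread x"
      using d1(2)[of e] s d unfolding spread_Theta[OF dom] e e_def[symmetric] by simp
    have nx: "norm x \<le> 4"
      using norm_bounded_of_gram[OF x] d3(2)[of e] s d e e_def by simp
    have "Theta x - x = x ** (step_matrix e - mat 1)"
      by (simp add: Theta_eq[OF x] e_def bounded_bilinear.diff_right[OF bounded_bilinear_matrix_mult])
    then have "norm (Theta x - x) \<le> norm x * norm (step_matrix e - mat 1) * K"
      using K(2) by simp
    also have "\<dots> \<le> 4 * (C * norm (e - unit_edges)) * K"
      using K(1) nx d2(3)[of e] s d e by (intro mult_right_mono mult_mono) auto
    finally show "norm (Theta x - x) \<le> 4 * C * K * spread x" by (simp add: e mult_ac)
  qed (use d d2 K in auto)
qed

section \<open>Charts of the rotation group\<close>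

text \<open>The rotation given by the quaternion 1 + a1 i + a2 j + a3 k; dividing by its squared
  norm spares a normalization of the quaternion. All rotations except the half turns arise.\<close>

definition rodrigues :: "real^3 \<Rightarrow> real^3^3" where
  "rodrigues a = (1 / (1 + (a$1)\<^sup>2 + (a$2)\<^sup>2 + (a$3)\<^sup>2)) *\<^sub>R vector [
     vector [1 + (a$1)\<^sup>2 - (a$2)\<^sup>2 - (a$3)\<^sup>2, 2 * (a$1 * a$2 - a$3), 2 * (a$1 * a$3 + a$2)],
     vector [2 * (a$1 * a$2 + a$3), 1 - (a$1)\<^sup>2 + (a$2)\<^sup>2 - (a$3)\<^sup>2, 2 * (a$2 * a$3 - a$1)],
     vector [2 * (a$1 * a$3 - a$2), 2 * (a$2 * a$3 + a$1), 1 - (a$1)\<^sup>2 - (a$2)\<^sup>2 + (a$3)\<^sup>2]]"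

text \<open>With n the denominator in \<open>rodrigues a\<close>, the skew differences of that
  matrix are 4 a/n and one plus its trace is 4/n, so the quotient recovers \<open>a\<close>.\<close>

definition rodrigues_axis :: "real^3^3 \<Rightarrow> real^3" where
  "rodrigues_axis r = (1 / (1 + trace r)) *\<^sub>R vector [r$3$2 - r$2$3, r$1$3 - r$3$1, r$2$1 - r$1$2]"

lemma one_plus_squares_pos: "1 + (a::real)\<^sup>2 + b\<^sup>2 + c\<^sup>2 > 0"
  by (intro add_pos_nonneg) auto

text \<open>After clearing the denominator n, orthogonality and determinant become the polynomial
  identities P^T P = n^2 and det P = n^3.\<close>

lemma rotation_matrix_rodrigues: "rotation_matrix (rodrigues a)"
proof -
  define x y z where a: "x = a$1" "y = a$2" "z = a$3"
  define n where "n = 1 + x\<^sup>2 + y\<^sup>2 + z\<^sup>2"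
  have n: "n \<noteq> 0" using one_plus_squares_pos[of x y z] by (simp add: n_def)
  define P :: "real^3^3" where "P = vector [
     vector [1 + x\<^sup>2 - y\<^sup>2 - z\<^sup>2, 2 * (x * y - z), 2 * (x * z + y)],
     vector [2 * (x * y + z), 1 - x\<^sup>2 + y\<^sup>2 - z\<^sup>2, 2 * (y * z - x)],
     vector [2 * (x * z - y), 2 * (y * z + x), 1 - x\<^sup>2 - y\<^sup>2 + z\<^sup>2]]"
  have R: "rodrigues a = (1/n) *\<^sub>R P"
    by (simp add: rodrigues_def n_def P_def a)
  have "(transpose P ** P) $ i $ j = (n\<^sup>2 *\<^sub>R mat 1 :: real^3^3) $ i $ j" for i j
  proof -
    have "\<forall>i j. (transpose P ** P) $ i $ j = (n\<^sup>2 *\<^sub>R mat 1 :: real^3^3) $ i $ j"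
      unfolding forall_3 matrix_matrix_mult_def transpose_def mat_def vec_lambda_beta sum_3 P_def vector_3 n_def
        vector_scaleR_component
      by (intro conjI; simp; algebra)
    then show ?thesis by blast
  qed
  then have PP: "transpose P ** P = n\<^sup>2 *\<^sub>R mat 1" by (simp add: vec_eq_iff)
  have "transpose (rodrigues a) ** rodrigues a = (1/n)\<^sup>2 *\<^sub>R (transpose P ** P)"
    by (simp add: R vec_eq_iff matrix_matrix_mult_def transpose_def sum_3 power2_eq_square algebra_simps add_divide_distrib)
  also have "\<dots> = mat 1" using n by (simp add: PP power_divide)
  finally have "orthogonal_matrix (rodrigues a)" by (simp add: orthogonal_matrix)
  moreover have "det P = n ^ 3"
    unfolding det_3 P_def vector_3 n_def by algebra
  then have "det (rodrigues a) = 1"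
    using n by (simp add: R det_3 power3_eq_cube field_simps)
  ultimately show ?thesis by (simp add: rotation_matrix_def)
qed

lemma trace_rodrigues: "1 + trace (rodrigues a) = 4 / (1 + (a$1)\<^sup>2 + (a$2)\<^sup>2 + (a$3)\<^sup>2)"
proof -
  define n where "n = 1 + (a$1)\<^sup>2 + (a$2)\<^sup>2 + (a$3)\<^sup>2"
  have n: "n \<noteq> 0" "(a$3)\<^sup>2 = n - 1 - (a$1)\<^sup>2 - (a$2)\<^sup>2"
    using one_plus_squares_pos[of "a$1" "a$2" "a$3"] by (simp_all add: n_def)
  show ?thesis
    unfolding rodrigues_def trace_def sum_3 n_def[symmetric] using n(1)
    by (simp add: field_simps) (simp add: n(2), algebra)
qed

lemma rodrigues_axis_rodrigues: "rodrigues_axis (rodrigues a) = a"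
proof -
  define n where "n = 1 + (a$1)\<^sup>2 + (a$2)\<^sup>2 + (a$3)\<^sup>2"
  have n: "n \<noteq> 0" using one_plus_squares_pos[of "a$1" "a$2" "a$3"] by (simp add: n_def)
  then show ?thesis
    unfolding rodrigues_axis_def trace_rodrigues unfolding rodrigues_def n_def[symmetric]
    by (simp add: vec_eq_iff forall_3 field_simps)
qed

text \<open>The entries of \<open>rodrigues\<close> are quadratic in the axis. For a rotation, all
  products of the skew differences u, v, w are t times affine expressions in the entries, where t is
  one plus the trace, so the quadratic terms collapse to the entries of \<open>r\<close>.\<close>

lemma rodrigues_rodrigues_axis:
  assumes r: "rotation_matrix r" and t0: "1 + trace r \<noteq> 0"
  shows "rodrigues (rodrigues_axis r) = r"
proof -
  define a b c d e f g h k where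
    r_def: "a = r$1$1" "b = r$1$2" "c = r$1$3" "d = r$2$1" "e = r$2$2" "f = r$2$3"
      "g = r$3$1" "h = r$3$2" "k = r$3$3"
  have "transpose r ** r = mat 1" "r ** transpose r = mat 1"
    using r by (auto simp: rotation_matrix_def orthogonal_matrix_def)
  then have "\<forall>i j. (transpose r ** r) $ i $ j = (mat 1 :: real^3^3) $ i $ j"
    "\<forall>i j. (r ** transpose r) $ i $ j = (mat 1 :: real^3^3) $ i $ j" by auto
  then have orth: "a\<^sup>2 + d\<^sup>2 + g\<^sup>2 = 1" "b\<^sup>2 + e\<^sup>2 + h\<^sup>2 = 1" "c\<^sup>2 + f\<^sup>2 + k\<^sup>2 = 1"
    "a*b + d*e + g*h = 0" "a*c + d*f + g*k = 0" "b*c + e*f + h*k = 0"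
    "a\<^sup>2 + b\<^sup>2 + c\<^sup>2 = 1" "d\<^sup>2 + e\<^sup>2 + f\<^sup>2 = 1" "g\<^sup>2 + h\<^sup>2 + k\<^sup>2 = 1"
    "a*d + b*e + c*f = 0" "a*g + b*h + c*k = 0" "d*g + e*h + f*k = 0"
    unfolding forall_3 matrix_matrix_mult_def transpose_def mat_def vec_lambda_beta sum_3 r_def[symmetric]
    by (auto simp: power2_eq_square)
  \<comment> \<open>Rotations preserve the cross product. On the standard basis this says that each
    entry of \<open>r\<close> equals its own cofactor, which is where determinant one
    enters.\<close>
  have "cross3 (r *v u) (r *v v) = r *v (cross3 u v)" for u v
    using cross_rotation_matrix[OF r] .
  from this[of "vector [1,0,0]" "vector [0,1,0]"] this[of "vector [0,1,0]" "vector [0,0,1]"]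
    this[of "vector [0,0,1]" "vector [1,0,0]"]
  have cof: "d*h - g*e = c" "g*b - a*h = f" "a*e - d*b = k" "e*k - h*f = a" "h*c - b*k = d" "b*f - e*c = g"
    "f*g - k*d = b" "k*a - c*g = e" "c*d - f*a = h"
    by (simp_all add: cross3_def vec_eq_iff forall_3 matrix_vector_mult_def sum_3 flip: r_def)
  define t where "t = 1 + a + e + k"
  have t: "1 + trace r = t" by (simp add: trace_def sum_3 t_def r_def)
  with t0 have t0: "t \<noteq> 0" by simp
  define u v w where uvw: "u = h - f" "v = c - g" "w = d - b"
  have sq: "u\<^sup>2 = 2*t*a - t\<^sup>2 + 2*t" "v\<^sup>2 = 2*t*e - t\<^sup>2 + 2*t" "w\<^sup>2 = 2*t*k - t\<^sup>2 + 2*t"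
    using orth cof unfolding uvw t_def by algebra+
  have pr: "u * v = t * (b + d)" "u * w = t * (c + g)" "v * w = t * (f + h)"
    using orth cof unfolding uvw t_def by algebra+
  \<comment> \<open>The counterpart of \<open>trace_rodrigues\<close>: the denominator of
    \<open>rodrigues\<close> at the computed axis.\<close>
  have n: "1 + (u/t)\<^sup>2 + (v/t)\<^sup>2 + (w/t)\<^sup>2 = 4/t"
  proof -
    have "u\<^sup>2 + v\<^sup>2 + w\<^sup>2 + t\<^sup>2 = 4 * t" unfolding sq t_def by algebra
    then show ?thesis using t0 by (simp add: field_simps power2_eq_square)
  qed
  have q: "(u/t)\<^sup>2 = 2*a/t - 1 + 2/t" "(v/t)\<^sup>2 = 2*e/t - 1 + 2/t" "(w/t)\<^sup>2 = 2*k/t - 1 + 2/t"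
    using t0 unfolding power_divide sq by (simp_all add: field_simps power2_eq_square)
  have p: "u/t * (v/t) = (b+d)/t" "u/t * (w/t) = (c+g)/t" "v/t * (w/t) = (f+h)/t"
    using t0 pr by (simp_all add: field_simps)
  have A: "rodrigues_axis r = vector [u/t, v/t, w/t]"
    unfolding rodrigues_axis_def t by (simp add: vec_eq_iff forall_3 uvw r_def)
  have "rodrigues (rodrigues_axis r) = vector [vector [a, b, c], vector [d, e, f], vector [g, h, k]]"
    unfolding A rodrigues_def vector_3 n p
    unfolding q
    using t0 by (simp add: vec_eq_iff forall_3 uvw field_simps) (simp add: t_def, algebra)
  also have "\<dots> = r" by (simp add: vec_eq_iff forall_3 r_def)
  finally show ?thesis .
qed

lemma continuous_on_vector_3:
  fixes u v w :: "'a::topological_space \<Rightarrow> 'b::{topological_space,zero}"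
  assumes "continuous_on S u" "continuous_on S v" "continuous_on S w"
  shows "continuous_on S (\<lambda>a. vector [u a, v a, w a] :: 'b^3)"
proof -
  have "\<forall>i. continuous_on S (\<lambda>a. (vector [u a, v a, w a] :: 'b^3) $ i)"
    using assms by (simp add: forall_3)
  then have "continuous_on S (\<lambda>a. \<chi> i. (vector [u a, v a, w a] :: 'b^3) $ i)"
    by (intro continuous_on_vec_lambda) blast
  then show ?thesis by simp
qed

lemma continuous_on_rodrigues: "continuous_on S rodrigues"
  unfolding rodrigues_def[abs_def]
  by (intro continuous_intros continuous_on_vector_3) (metis one_plus_squares_pos less_irrefl)

lemma continuous_on_rodrigues_axis: "continuous_on {r. 1 + trace r \<noteq> 0} rodrigues_axis"
  unfolding rodrigues_axis_def[abs_def] trace_def sum_3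
  by (intro continuous_intros continuous_on_vector_3) auto

lemma rotation_matrix_mult: "rotation_matrix r \<Longrightarrow> rotation_matrix s \<Longrightarrow> rotation_matrix (r ** s)"
  for r s :: "real^3^3"
  by (auto simp: rotation_matrix_def det_mul intro!: orthogonal_matrix_mul)

lemma rotation_matrix_transpose: "rotation_matrix r \<Longrightarrow> rotation_matrix (transpose r)"
  by (simp add: rotation_matrix_def orthogonal_matrix_transpose det_transpose)

lemma SO3_orbit_mult: "rotation_matrix r \<Longrightarrow> SO3_orbit (r ** x) = SO3_orbit x"
proof (intro equalityI subsetI)
  fix y assume r: "rotation_matrix r" and "y \<in> SO3_orbit (r ** x)"
  then show "y \<in> SO3_orbit x"
    unfolding SO3_orbit_def by (auto simp: matrix_mul_assoc intro: rotation_matrix_mult)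
next
  fix y assume r: "rotation_matrix r" and "y \<in> SO3_orbit x"
  then obtain s where s: "rotation_matrix s" "y = s ** x" by (auto simp: SO3_orbit_def)
  have "y = (s ** transpose r) ** (r ** x)"
    using r s by (simp add: rotation_matrix_def orthogonal_matrix_def matrix_mul_assoc flip: matrix_mul_assoc[of s])
  moreover have "rotation_matrix (s ** transpose r)"
    using r s by (intro rotation_matrix_mult rotation_matrix_transpose)
  ultimately show "y \<in> SO3_orbit (r ** x)" unfolding SO3_orbit_def by blast
qed

text \<open>Around each point \<open>p\<close> of the orbit, the points r p with r not a half turn
  form an open set, and the Rodrigues parameters of r identify it with all of R^3.\<close>

lemma three_dimensional_SO3_orbit:
  assumes "invertible x"
  shows "three_dimensional (SO3_orbit x)"
  unfolding three_dimensional_def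
proof (intro conjI ballI)
  have "rotation_matrix (mat 1 :: real^3^3)" by (simp add: rotation_matrix_def orthogonal_matrix_id)
  then show "SO3_orbit x \<noteq> {}" by (auto simp: SO3_orbit_def)
  fix p assume "p \<in> SO3_orbit x"
  then obtain s where s: "rotation_matrix s" "p = s ** x" by (auto simp: SO3_orbit_def)
  \<comment> \<open>Taking \<open>p\<close> as the base point reduces every chart to the one around
    the identity rotation.\<close>
  then have orbit: "SO3_orbit x = SO3_orbit p" by (simp add: SO3_orbit_mult)
  have "det p \<noteq> 0" using s assms by (simp add: det_mul rotation_matrix_def invertible_det_nz)
  then obtain q where inv: "p ** q = mat 1" "q ** p = mat 1"
    by (metis invertible_det_nz invertible_def)
  define V where "V = {y \<in> SO3_orbit p. 1 + trace (y ** q) \<noteq> 0}"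
  have V: "V = {r ** p |r. rotation_matrix r \<and> 1 + trace r \<noteq> 0}"
    unfolding V_def SO3_orbit_def using inv by (auto simp flip: matrix_mul_assoc)
  have cont_mult: "continuous_on S (\<lambda>y. y ** q)" for S :: "(real^3^3) set" and q :: "real^3^3"
    using bounded_linear.continuous_on[OF bounded_bilinear.bounded_linear_left[OF bounded_bilinear_matrix_mult, of q] continuous_on_id[of S]]
    by simp
  have "continuous_on (SO3_orbit p) (\<lambda>y. 1 + trace (y ** q))"
    unfolding trace_def by (intro continuous_intros cont_mult)
  then have "openin (top_of_set (SO3_orbit p)) (SO3_orbit p \<inter> (\<lambda>y. 1 + trace (y ** q)) -` (- {0}))"
    by (rule continuous_openin_preimage_gen) auto
  then have "openin (top_of_set (SO3_orbit p)) V"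
    by (simp add: V_def vimage_def Int_def)
  moreover have "p \<in> V"
  proof -
    have "1 + trace (mat 1 :: real^3^3) \<noteq> 0" by (simp add: trace_def mat_def sum_3)
    then show ?thesis unfolding V using \<open>rotation_matrix (mat 1)\<close>
      by (auto intro!: exI[of _ "mat 1"])
  qed
  moreover have "V homeomorphic (UNIV :: (real^3) set)"
    unfolding homeomorphic_def homeomorphism_def
  proof (intro exI conjI ballI)
    let ?f = "\<lambda>y. rodrigues_axis (y ** q)" and ?g = "\<lambda>a. rodrigues a ** p"
    have ne: "1 + trace (rodrigues a) \<noteq> 0" for a
      unfolding trace_rodrigues using one_plus_squares_pos[of "a$1" "a$2" "a$3"] by simp
    show "continuous_on V ?f"
      by (rule continuous_on_compose2[OF continuous_on_rodrigues_axis cont_mult]) (auto simp: V_def)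
    show "continuous_on UNIV ?g"
      by (rule continuous_on_compose2[OF cont_mult continuous_on_rodrigues]) auto
    show fg: "?f (?g a) = a" for a
      using inv by (simp add: rodrigues_axis_rodrigues flip: matrix_mul_assoc)
    show gf: "?g (?f y) = y" if "y \<in> V" for y
      using that inv unfolding V by (auto simp: rodrigues_rodrigues_axis simp flip: matrix_mul_assoc)
    show img: "?g ` UNIV = V"
    proof
      show "?g ` UNIV \<subseteq> V" unfolding V using rotation_matrix_rodrigues ne by blast
      show "V \<subseteq> ?g ` UNIV"
      proof
        fix y assume "y \<in> V"
        from gf[OF this, symmetric] show "y \<in> ?g ` UNIV" by (rule image_eqI) simp
      qed
    qed
    show "?f ` V = UNIV"
      unfolding img[symmetric] image_image fg by simp
  qed
  ultimately show "\<exists>V W. openin (top_of_set (SO3_orbit x)) V \<and> p \<in> V \<and> open (W :: (real^3) set) \<and> V homeomorphic W"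
    unfolding orbit using open_UNIV by blast
qed

section \<open>The orbit of a regular tetrahedron\<close>

lemma gram_inject: "gram e = gram e' \<longleftrightarrow> e = e'"
  by (cases e; cases e') (auto simp: gram_def vec_eq_iff forall_3)

lemma sq_edges_rotation:
  assumes "rotation_matrix r"
  shows "sq_edges (r ** x) = sq_edges x"
proof -
  have "transpose (r ** x) ** (r ** x) = transpose x ** ((transpose r ** r) ** x)"
    by (simp only: matrix_transpose_mul matrix_mul_assoc)
  also have "\<dots> = transpose x ** x"
    using assms by (simp add: rotation_matrix_def orthogonal_matrix_def)
  finally show ?thesis by (simp only: gram_sq_edges gram_inject)
qed

text \<open>Squared edges determine the Gram matrix. If y and x have the same one, then y x^-1 is
  orthogonal, and equal determinants make it a rotation.\<close>

lemma SO3_orbit_eq: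
  assumes "x \<in> SL3"
  shows "SO3_orbit x = {y \<in> SL3. sq_edges y = sq_edges x}"
proof (intro equalityI subsetI)
  fix y assume "y \<in> SO3_orbit x"
  then show "y \<in> {y \<in> SL3. sq_edges y = sq_edges x}"
    using assms by (auto simp: SO3_orbit_def SL3_def sq_edges_rotation det_mul rotation_matrix_def)
next
  fix y assume y: "y \<in> {y \<in> SL3. sq_edges y = sq_edges x}"
  have "det x \<noteq> 0" using assms by (simp add: SL3_def)
  then obtain q where q: "x ** q = mat 1" "q ** x = mat 1"
    by (metis invertible_det_nz invertible_def)
  have "transpose y ** y = transpose x ** x" using y by (simp add: gram_sq_edges)
  then have "transpose q ** ((transpose y ** y) ** q) = transpose q ** ((transpose x ** x) ** q)"
    by simp
  then have "transpose (y ** q) ** (y ** q) = transpose (x ** q) ** (x ** q)"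
    by (simp only: matrix_transpose_mul matrix_mul_assoc)
  then have "orthogonal_matrix (y ** q)" by (simp add: orthogonal_matrix q)
  moreover have "det (y ** q) = det (x ** q)" using y assms by (simp add: det_mul SL3_def)
  ultimately have "rotation_matrix (y ** q)" by (simp add: rotation_matrix_def q)
  moreover have "y = (y ** q) ** x" by (simp add: q flip: matrix_mul_assoc)
  ultimately show "y \<in> SO3_orbit x" unfolding SO3_orbit_def by blast
qed

text \<open>Zero spread leaves only a scale c, and the Gram determinant of c times
  \<open>unit_edges\<close> is c^3/2, which must be 1.\<close>

lemma spread_eq_0_iff:
  assumes "x \<in> SL3"
  shows "spread x = 0 \<longleftrightarrow> sq_edges x = root 3 2 *\<^sub>R unit_edges"
proof
  assume "spread x = 0"
  define c where "c = edge_sum (sq_edges x) / 6"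
  have c: "c > 0" "sq_edges x = c *\<^sub>R unit_edges"
    using edge_sum_sq_edges_pos[OF assms] normalized_eq[of "sq_edges x"] \<open>spread x = 0\<close>
    by (auto simp: c_def spread_def)
  have "det (gram (sq_edges x)) = 1" using assms by (simp add: det_gram_sq_edges SL3_def)
  then have "c ^ 3 = 2" by (simp add: c gram_scale det_scaleR3 det_gram_unit)
  then have "c = root 3 2" using c(1) by (metis real_root_pos2 less_imp_le zero_less_numeral)
  with c(2) show "sq_edges x = root 3 2 *\<^sub>R unit_edges" by simp
next
  assume "sq_edges x = root 3 2 *\<^sub>R unit_edges"
  then show "spread x = 0" by (simp add: spread_def normalized_scale normalized_unit)
qed

lemma regular_tetrahedron_spread:
  assumes "x \<in> SL3" "regular_tetrahedron x"
  shows "spread x = 0"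
proof -
  obtain l where "\<forall>i\<le>3. \<forall>j\<le>3. i \<noteq> j \<longrightarrow> dist (vertex x i) (vertex x j) = l"
    using assms(2) unfolding regular_tetrahedron_def by (rule exE)
  note l = this[rule_format]
  have "sq_edges x = l\<^sup>2 *\<^sub>R unit_edges"
    using l[of 3 0] l[of 1 3] l[of 2 3] l[of 1 2] l[of 2 0] l[of 1 0]
    by (simp add: sq_edges_def unit_edges_def vertex_numeral dist_norm)
  moreover from this have "l\<^sup>2 \<noteq> 0" using edge_sum_sq_edges_pos[OF assms(1)] by (auto simp: edge_sum_scale)
  ultimately show ?thesis by (simp add: spread_def normalized_scale normalized_unit)
qed

lemma SO3_orbit_regular:
  assumes "x \<in> SL3" "regular_tetrahedron x"
  shows "SO3_orbit x = {y \<in> SL3. spread y = 0}"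
  using regular_tetrahedron_spread[OF assms] spread_eq_0_iff[OF assms(1)] spread_eq_0_iff SO3_orbit_eq[OF assms(1)]
  by auto

text \<open>Here the multiplier is \<open>step_matrix unit_edges\<close>, the identity. The orbit is
  thus fixed point by point, not merely as a set.\<close>

lemma Theta_fixed: "x \<in> SL3 \<Longrightarrow> spread x = 0 \<Longrightarrow> Theta x = x"
  by (simp add: Theta_eq spread_def step_matrix_unit)

section \<open>Compactness of the orbit and continuity of the transformation\<close>

lemma closed_SL3: "closed SL3"
  unfolding SL3_def by (intro closed_Collect_eq continuous_on_det continuous_on_const)

lemma compact_SO3_orbit:
  assumes "x \<in> SL3"
  shows "compact (SO3_orbit x)"
proof -
  have "closed (SL3 \<inter> {y. sq_edges y = sq_edges x})"
    by (intro closed_Int closed_SL3 closed_Collect_eq continuous_on_sq_edges continuous_on_const)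
  moreover have "norm y \<le> sqrt (edge_sum (sq_edges x))" if "sq_edges y = sq_edges x" for y
    using edge_sum_sq_edges[of y] that by (simp add: real_le_rsqrt)
  then have "bounded (SL3 \<inter> {y. sq_edges y = sq_edges x})" by (auto simp: bounded_iff)
  ultimately show ?thesis
    unfolding SO3_orbit_eq[OF assms] by (simp add: compact_eq_bounded_closed Int_def)
qed

lemma columns_independent:
  fixes x :: "real^3^3"
  assumes "det x \<noteq> 0" "a *\<^sub>R column 1 x + b *\<^sub>R column 2 x + c *\<^sub>R column 3 x = 0"
  shows "a = 0 \<and> b = 0 \<and> c = 0"
proof -
  have "x *v vector [a, b, c] = 0"
    using assms(2) by (simp add: vec_eq_iff matrix_vector_mult_def sum_3 column_def mult.commute)
  then have "(vector [a, b, c] :: real^3) = 0"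
    using assms(1) by (metis invertible_det_nz invertible_def matrix_vector_mul_assoc matrix_vector_mul_lid matrix_vector_mult_0_right)
  then show ?thesis by (metis vector_3 zero_index)
qed

text \<open>A vertex p at the centroid would give 2p = q + r for the other two vertices, a
  nontrivial linear relation between the columns. This keeps the denominators in
  \<open>theta\<close> nonzero.\<close>

lemma vertex_neq_centroid:
  assumes "x \<in> SL3" "i < 4" "j < 3"
  shows "vertex x (face i ! j) \<noteq> face_centroid x i"
proof
  assume eq: "vertex x (face i ! j) = face_centroid x i"
  have det: "det x \<noteq> 0" using assms(1) by (simp add: SL3_def)
  have sum: "(\<Sum>j<3::nat. f j) = f 0 + f 1 + f 2" for f :: "nat \<Rightarrow> real^3"
    by (simp add: numeral_eq_Suc)
  have "i = 0 \<or> i = 1 \<or> i = 2 \<or> i = 3" "j = 0 \<or> j = 1 \<or> j = 2" using assms by auto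
  moreover have "3 *\<^sub>R vertex x (face i ! j) = vertex x (face i ! 0) + vertex x (face i ! 1) + vertex x (face i ! 2)"
    unfolding eq face_centroid_def sum by simp
  ultimately show False
    \<comment> \<open>The twelve coefficient triples belong to the relations 2p - q - r = 0, up to
      sign, one for each vertex of each face; vertex 0 contributes nothing.\<close>
    using columns_independent[OF det, of 1 0 1] columns_independent[OF det, of 2 0 "-1"]
      columns_independent[OF det, of "-1" 0 2] columns_independent[OF det, of 2 "-1" "-1"]
      columns_independent[OF det, of "-1" 2 "-1"] columns_independent[OF det, of "-1" "-1" 2]
      columns_independent[OF det, of 0 2 "-1"] columns_independent[OF det, of 0 1 1]
      columns_independent[OF det, of 0 "-1" 2] columns_independent[OF det, of 1 1 0]
      columns_independent[OF det, of 2 "-1" 0] columns_independent[OF det, of "-1" 2 0]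
    by (elim disjE; simp add: face_def vertex_numeral scaleR_3 scaleR_2 algebra_simps)
qed

lemma continuous_on_vertex: "continuous_on S (\<lambda>x. vertex x k)"
proof -
  have "continuous_on S (\<lambda>x. column j x :: real^3)" for j :: 3 and S :: "(real^3^3) set"
    unfolding column_def by (intro continuous_intros)
  then show ?thesis
    by (cases "(undefined :: real^3^3, k)" rule: vertex.cases) simp_all
qed

lemma continuous_on_theta:
  assumes "i < 4" "j < 3"
  shows "continuous_on SL3 (theta i j)"
  unfolding theta_def[abs_def] Let_def face_centroid_def
  by (intro continuous_intros continuous_on_vertex)
     (use vertex_neq_centroid[OF _ assms] in \<open>simp add: face_centroid_def\<close>)

lemma continuous_on_transpose:
  fixes f :: "'a::topological_space \<Rightarrow> real^3^3"
  assumes "continuous_on S f"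
  shows "continuous_on S (\<lambda>x. transpose (f x))"
  unfolding transpose_def by (intro continuous_intros assms)

lemma continuous_on_Theta_tilde: "continuous_on SL3 Theta_tilde"
  unfolding Theta_tilde_def[abs_def] Let_def
  by (intro continuous_on_transpose continuous_on_vector_3 continuous_intros continuous_on_theta) simp_all

lemma continuous_on_Theta: "continuous_on Theta_dom Theta"
proof -
  have t: "continuous_on Theta_dom Theta_tilde"
    using continuous_on_Theta_tilde by (rule continuous_on_subset) (auto simp: Theta_dom_def)
  have "continuous_on Theta_dom (\<lambda>x. det (Theta_tilde x))"
    by (rule continuous_on_compose2[OF continuous_on_det[of UNIV] t]) simp
  then show ?thesis
    unfolding Theta_def[abs_def]
    by (intro continuous_intros continuous_on_det t) (auto simp: Theta_dom_def invertible_det_nz)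
qed

section \<open>Convergence of the iterates and the attractor\<close>

lemma convergent_geometric_steps:
  fixes x :: "nat \<Rightarrow> 'a::banach"
  assumes "\<And>n. norm (x (Suc n) - x n) \<le> C * k ^ n" "0 \<le> k" "k < 1"
  shows "convergent x"
proof -
  \<comment> \<open>The increments are dominated by a geometric series, and their partial sums
    telescope.\<close>
  have "summable (\<lambda>n. x (Suc n) - x n)"
    by (rule summable_comparison_test'[where g="\<lambda>n. C * k ^ n" and N=0])
       (use assms in \<open>auto intro!: summable_mult summable_geometric\<close>)
  then have "convergent (\<lambda>n. \<Sum>i<n. x (Suc i) - x i)" by (simp add: summable_iff_convergent)
  then have "convergent (\<lambda>n. x n - x 0)" by (simp add: sum_lessThan_telescope)
  then show ?thesis by (simp add: convergent_diff_const_right_iff)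
qed

theorem lemma4p1:
  fixes x_eq :: "real^3^3"
  assumes "x_eq \<in> SL3" and "regular_tetrahedron x_eq"
  shows "local_attractor SL3 Theta_dom Theta (SO3_orbit x_eq) \<and>
    three_dimensional (SO3_orbit x_eq) \<and>
    Theta ` SO3_orbit x_eq = SO3_orbit x_eq \<and>
    (\<exists>U. openin (top_of_set SL3) U \<and> SO3_orbit x_eq \<subseteq> U \<and>
      (\<forall>x\<in>U. (\<forall>n. (Theta ^^ n) x \<in> Theta_dom) \<and>
        (\<exists>xs \<in> SO3_orbit x_eq. (\<lambda>n. (Theta ^^ n) x) \<longlonglongrightarrow> xs)))"
proof -
  define A where "A = SO3_orbit x_eq"
  have A: "A = {x \<in> SL3. spread x = 0}" unfolding A_def by (rule SO3_orbit_regular[OF assms])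
  obtain d C where d: "d > 0" "C > 0"
    and dom: "\<And>x. x \<in> SL3 \<Longrightarrow> spread x < d \<Longrightarrow> x \<in> Theta_dom"
    and contr: "\<And>x. x \<in> SL3 \<Longrightarrow> spread x < d \<Longrightarrow> spread (Theta x) \<le> 35/36 * spread x"
    and step: "\<And>x. x \<in> SL3 \<Longrightarrow> spread x < d \<Longrightarrow> norm (Theta x - x) \<le> C * spread x"
    using basin_exists by metis
  \<comment> \<open>A sublevel set of \<open>spread\<close> is automatically invariant, because one
    step shrinks the spread.\<close>
  define U where "U = {x \<in> SL3. spread x < d}"
  have spread_ge: "spread x \<ge> 0" for x by (simp add: spread_def)
  have openU: "openin (top_of_set SL3) U"
    using continuous_openin_preimage_gen[OF continuous_on_spread, of "{..<d}"]
    by (simp add: U_def vimage_def Int_def)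
  have AU: "A \<subseteq> U" using d by (auto simp: A U_def)
  have UD: "U \<subseteq> Theta_dom" using dom by (auto simp: U_def)
  have inv: "Theta x \<in> U" if "x \<in> U" for x
  proof -
    have "spread (Theta x) \<le> 35/36 * spread x" using contr that by (simp add: U_def)
    also have "\<dots> < d" using that spread_ge[of x] by (simp add: U_def)
    finally show ?thesis using Theta_mem_SL3 UD that by (auto simp: U_def)
  qed
  have iter: "(Theta ^^ n) x \<in> U \<and> spread ((Theta ^^ n) x) \<le> d * (35/36) ^ n" if "x \<in> U" for x n
  proof (induction n)
    case 0
    then show ?case using that by (simp add: U_def)
  next
    case (Suc n)
    then have "spread (Theta ((Theta ^^ n) x)) \<le> 35/36 * spread ((Theta ^^ n) x)"
      using contr by (simp add: U_def)
    also have "\<dots> \<le> 35/36 * (d * (35/36) ^ n)" using Suc by simp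
    finally show ?case using inv Suc by simp
  qed
  have small: "(\<lambda>n. d * (35/36) ^ n) \<longlonglongrightarrow> 0"
    by (intro tendsto_mult_right_zero LIMSEQ_realpow_zero) auto
  have fixed: "Theta x = x" if "x \<in> A" for x
    using that Theta_fixed by (simp add: A)
  have fixn: "(Theta ^^ n) x = x" if "x \<in> A" for x n
    using fixed[OF that] by (induction n) auto
  \<comment> \<open>A point in all images is an n-th iterate for every n, so its spread lies below
    every term of a null sequence. Conversely, points of \<open>A\<close> are fixed and serve as
    their own preimages.\<close>
  have inter: "(\<Inter>n. (Theta ^^ n) ` U) = A"
  proof (intro equalityI subsetI)
    fix y assume y: "y \<in> (\<Inter>n. (Theta ^^ n) ` U)"
    have *: "y \<in> U \<and> spread y \<le> d * (35/36) ^ n" for n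
    proof -
      have "y \<in> (Theta ^^ n) ` U" using y by (rule INT_D) simp
      then obtain u where "u \<in> U" "y = (Theta ^^ n) u" by (rule imageE) simp
      then show ?thesis using iter by simp
    qed
    then have "spread y \<le> 0" using small by (intro LIMSEQ_le_const) auto
    then show "y \<in> A" using * spread_ge[of y] by (auto simp: A U_def)
  next
    fix y assume "y \<in> A"
    then show "y \<in> (\<Inter>n. (Theta ^^ n) ` U)"
      using fixn AU by (intro INT_I image_eqI[of y _ y]) auto
  qed
  have img: "Theta ` A = A" using fixed by force
  have lim: "\<exists>xs\<in>A. (\<lambda>n. (Theta ^^ n) x) \<longlonglongrightarrow> xs" if "x \<in> U" for x
  proof -
    \<comment> \<open>The displacement is bounded by the spread, which decays geometrically along
      the orbit.\<close>
    have "norm ((Theta ^^ Suc n) x - (Theta ^^ n) x) \<le> (C * d) * (35/36) ^ n" for n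
    proof -
      have "norm (Theta ((Theta ^^ n) x) - (Theta ^^ n) x) \<le> C * spread ((Theta ^^ n) x)"
        using step iter[OF that, of n] by (simp add: U_def)
      also have "\<dots> \<le> C * (d * (35/36) ^ n)" using iter[OF that, of n] d by simp
      finally show ?thesis by simp
    qed
    then have "convergent (\<lambda>n. (Theta ^^ n) x)"
      by (rule convergent_geometric_steps) auto
    then obtain xs where xs: "(\<lambda>n. (Theta ^^ n) x) \<longlonglongrightarrow> xs" by (auto simp: convergent_def)
    have SL: "(Theta ^^ n) x \<in> SL3" for n using iter[OF that] by (simp add: U_def)
    \<comment> \<open>Closedness of \<open>SL3\<close> keeps the limit in the domain where
      \<open>spread\<close> is continuous, so the spread of the limit is the limit of the spreads,
      namely 0.\<close>
    then have "xs \<in> SL3" using closed_SL3 xs by (metis closed_sequentially)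
    then have "(\<lambda>n. spread ((Theta ^^ n) x)) \<longlonglongrightarrow> spread xs"
      using continuous_on_tendsto_compose[OF continuous_on_spread xs] SL by simp
    moreover have "(\<lambda>n. spread ((Theta ^^ n) x)) \<longlonglongrightarrow> 0"
      by (rule tendsto_sandwich[OF _ _ tendsto_const small])
         (use iter[OF that] spread_ge in auto)
    ultimately have "spread xs = 0" by (rule LIMSEQ_unique)
    with \<open>xs \<in> SL3\<close> xs show ?thesis by (auto simp: A)
  qed
  have "local_attractor SL3 Theta_dom Theta A"
    unfolding local_attractor_def
  proof (intro conjI exI[of _ U])
    show "Theta_dom \<subseteq> SL3" by (auto simp: Theta_dom_def)
    show "compact A" unfolding A_def by (rule compact_SO3_orbit[OF assms(1)])
    show "Theta ` Theta_dom \<subseteq> SL3" "Theta ` U \<subseteq> U" using Theta_mem_SL3 inv by auto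
    show "Theta ` A \<subseteq> A" using img by simp
  qed (rule continuous_on_Theta openU AU UD inter)+
  moreover have "three_dimensional A"
    unfolding A_def using assms(1) by (intro three_dimensional_SO3_orbit) (simp add: invertible_det_nz SL3_def)
  ultimately show ?thesis
    unfolding A_def[symmetric]
    using img openU AU lim iter UD by (intro conjI exI[of _ U] ballI allI) (simp_all add: subset_iff)
qed

end
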